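(* Let $P$ be a poset and let $\mathfrak F=(F_n,\phi_n)$ be a chain complex of modules over a ring with a fixed $P$-stratification $F_n=\bigoplus_{a\in P}F_n^a$. (a) A vector field $V$ on $\mathfrak F$ compatible with the stratification induces for each $a\in P$ a canonical vector field $\overline{V(a)}$ on the stratum $\overline{\mathfrak F(a)}$. (b) Suppose that for each $a\in P$ we are given a vector field $W_a$ on the chain complex $\overline{\mathfrak F(a)}$. Via the inclusion $\overline{\mathfrak F(a)}_n=F_n^a\subseteq F_n$, each $W_a$ induces a vector field (also denoted by $W_a$) on $\mathfrak F$ by setting $W_a(F_n^b)=0$ for $b\ne a$. (c) Let the vector fields $W_a$ be as in part (b), and let $W=\sum_{a\in P}W_a$. Then $W$ is a vector field on $\mathfrak F$ compatible with the given stratification, and such that $\overline{W(a)}=W_a$ for every $a\in P$.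
   Context: Rings are associative with unit, modules are left and unitary. A chain homotopy on $\mathfrak F$ is a family of module homomorphisms $F_n\to F_{n+1}$. A vector field on $\mathfrak F$ is a chain homotopy $V$ with $V^2=0$. A $P$-grading or $P$-stratification on $\mathfrak F$ is a decomposition $F_n=\bigoplus_{a\in P}F_n^a$ for every $n$ such that for each $a\in P$ the modules $F_n(a)=\bigoplus_{x\le a}F_n^x$ form a subcomplex $\mathfrak F(a)$ of $\mathfrak F$. The stratum at $a$ is the chain complex $\overline{\mathfrak F(a)}=\mathfrak F(a)/\sum_{b<a}\mathfrak F(b)$; thus $\overline{\mathfrak F(a)}_n=F_n^a$. A vector field $V$ is compatible with the stratification if $V(F_n^a)\subseteq F_{n+1}^a$ for all $a\in P$ and all $n$; the induced map on $\overline{\mathfrak F(a)}$ is denoted $\overline{V(a)}$. *)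

theory Defs
  imports "HOL-Algebra.Module" "HOL-Algebra.AbelCoset" "HOL-Algebra.Order"
begin

section \<open>Left modules over a not necessarily commutative ring\<close>

text \<open>The library locale \<^locale>\<open>module\<close> insists on a commutative ring; the following one has the
  same axioms over an arbitrary (unital, associative) \<^locale>\<open>ring\<close>.  As in the library, the
  multiplicative part of a module record is meaningless.\<close>

locale left_module = R?: ring R + M?: abelian_group M
    for R :: "('r, 'x) ring_scheme" (structure) and M :: "('r, 'm, 'y) module_scheme" (structure) +
  assumes smult_closed [simp, intro]:
      "\<lbrakk>r \<in> carrier R; x \<in> carrier M\<rbrakk> \<Longrightarrow> r \<odot>\<^bsub>M\<^esub> x \<in> carrier M"
    and smult_l_distr:
      "\<lbrakk>r \<in> carrier R; s \<in> carrier R; x \<in> carrier M\<rbrakk> \<Longrightarrow>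
       (r \<oplus> s) \<odot>\<^bsub>M\<^esub> x = r \<odot>\<^bsub>M\<^esub> x \<oplus>\<^bsub>M\<^esub> s \<odot>\<^bsub>M\<^esub> x"
    and smult_r_distr:
      "\<lbrakk>r \<in> carrier R; x \<in> carrier M; y \<in> carrier M\<rbrakk> \<Longrightarrow>
       r \<odot>\<^bsub>M\<^esub> (x \<oplus>\<^bsub>M\<^esub> y) = r \<odot>\<^bsub>M\<^esub> x \<oplus>\<^bsub>M\<^esub> r \<odot>\<^bsub>M\<^esub> y"
    and smult_assoc:
      "\<lbrakk>r \<in> carrier R; s \<in> carrier R; x \<in> carrier M\<rbrakk> \<Longrightarrow>
       (r \<otimes> s) \<odot>\<^bsub>M\<^esub> x = r \<odot>\<^bsub>M\<^esub> (s \<odot>\<^bsub>M\<^esub> x)"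
    and smult_one [simp]:
      "x \<in> carrier M \<Longrightarrow> \<one> \<odot>\<^bsub>M\<^esub> x = x"

definition module_hom_set ::
  "('r, 'x) ring_scheme \<Rightarrow> ('r, 'm) module \<Rightarrow> ('r, 'n) module \<Rightarrow> ('m \<Rightarrow> 'n) set" where
  "module_hom_set R M N =
     {h \<in> hom (add_monoid M) (add_monoid N).
        \<forall>r\<in>carrier R. \<forall>x\<in>carrier M. h (r \<odot>\<^bsub>M\<^esub> x) = r \<odot>\<^bsub>N\<^esub> h x}"

text \<open>Internal sums of families of submodules.  Since \<^const>\<open>finsum\<close> is only meaningful over
  finite index sets, sums over \<open>I\<close> are taken over finite subsets of \<open>I\<close> or over finite supports.\<close>

definition submodule_sum :: "('r, 'm) module \<Rightarrow> 'p set \<Rightarrow> ('p \<Rightarrow> 'm set) \<Rightarrow> 'm set" where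
  "submodule_sum M I S =
     {finsum M f J | f J. finite J \<and> J \<subseteq> I \<and> f \<in> (\<Pi> i\<in>J. S i)}"

definition finsupp_sum :: "('r, 'm) module \<Rightarrow> 'p set \<Rightarrow> ('p \<Rightarrow> 'm) \<Rightarrow> 'm" where
  "finsupp_sum M I f = finsum M f {i \<in> I. f i \<noteq> \<zero>\<^bsub>M\<^esub>}"

definition is_decomposition ::
  "('r, 'm) module \<Rightarrow> 'p set \<Rightarrow> ('p \<Rightarrow> 'm set) \<Rightarrow> 'm \<Rightarrow> ('p \<Rightarrow> 'm) \<Rightarrow> bool" where
  "is_decomposition M I S x f \<longleftrightarrow>
     f \<in> (\<Pi>\<^sub>E i\<in>I. S i) \<and> finite {i \<in> I. f i \<noteq> \<zero>\<^bsub>M\<^esub>} \<and> x = finsupp_sum M I f"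

definition internal_direct_sum ::
  "('r, 'x) ring_scheme \<Rightarrow> ('r, 'm) module \<Rightarrow> 'p set \<Rightarrow> ('p \<Rightarrow> 'm set) \<Rightarrow> bool" where
  "internal_direct_sum R M I S \<longleftrightarrow>
     (\<forall>i\<in>I. submodule (S i) R M) \<and> (\<forall>x\<in>carrier M. \<exists>!f. is_decomposition M I S x f)"

definition component ::
  "('r, 'm) module \<Rightarrow> 'p set \<Rightarrow> ('p \<Rightarrow> 'm set) \<Rightarrow> 'p \<Rightarrow> 'm \<Rightarrow> 'm" where
  "component M I S i x = (THE f. is_decomposition M I S x f) i"

text \<open>\<open>quot_map M N h\<close> is the map \<open>X \<mapsto> N + h x\<close> (\<open>x \<in> X\<close>) induced by \<open>h\<close> on cosets with
  values in cosets of \<open>N \<subseteq> M\<close>; the union is one of equal cosets whenever \<open>h\<close> descends to the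
  quotients.\<close>

definition quot_map ::
  "('r, 'm) module \<Rightarrow> 'm set \<Rightarrow> ('l \<Rightarrow> 'm) \<Rightarrow> 'l set \<Rightarrow> 'm set" where
  "quot_map M N h X = (\<Union>x\<in>X. N +>\<^bsub>M\<^esub> h x)"

definition quot_module :: "('r, 'm) module \<Rightarrow> 'm set \<Rightarrow> ('r, 'm set) module" where
  "quot_module M N =
     \<lparr>carrier = a_rcosets\<^bsub>M\<^esub> N, mult = (\<lambda>_ _. N), one = N, zero = N,
      add = set_add M, smult = (\<lambda>r. quot_map M N (\<lambda>x. r \<odot>\<^bsub>M\<^esub> x))\<rparr>"


section \<open>Chain complexes and vector fields\<close>

record ('r, 'm) chain_cpx =
  chain_mod :: "int \<Rightarrow> ('r, 'm) module"
  bdry :: "int \<Rightarrow> 'm \<Rightarrow> 'm"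

definition chain_complex :: "('r, 'x) ring_scheme \<Rightarrow> ('r, 'm) chain_cpx \<Rightarrow> bool" where
  "chain_complex R F \<longleftrightarrow>
     (\<forall>n. left_module R (chain_mod F n)) \<and>
     (\<forall>n. bdry F n \<in> module_hom_set R (chain_mod F n) (chain_mod F (n - 1))) \<and>
     (\<forall>n. \<forall>x\<in>carrier (chain_mod F n). bdry F (n - 1) (bdry F n x) = \<zero>\<^bsub>chain_mod F (n - 1 - 1)\<^esub>)"

definition subcomplex ::
  "('r, 'x) ring_scheme \<Rightarrow> ('r, 'm) chain_cpx \<Rightarrow> (int \<Rightarrow> 'm set) \<Rightarrow> bool" where
  "subcomplex R F G \<longleftrightarrow>
     (\<forall>n. submodule (G n) R (chain_mod F n)) \<and> (\<forall>n. bdry F n ` G n \<subseteq> G (n - 1))"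

definition restrict_cpx :: "('r, 'm) chain_cpx \<Rightarrow> (int \<Rightarrow> 'm set) \<Rightarrow> ('r, 'm) chain_cpx" where
  "restrict_cpx F G =
     \<lparr>chain_mod = (\<lambda>n. (chain_mod F n)\<lparr>carrier := G n\<rparr>), bdry = bdry F\<rparr>"

definition quot_cpx :: "('r, 'm) chain_cpx \<Rightarrow> (int \<Rightarrow> 'm set) \<Rightarrow> ('r, 'm set) chain_cpx" where
  "quot_cpx F G =
     \<lparr>chain_mod = (\<lambda>n. quot_module (chain_mod F n) (G n)),
      bdry = (\<lambda>n. quot_map (chain_mod F (n - 1)) (G (n - 1)) (bdry F n))\<rparr>"

definition chain_homotopy ::
  "('r, 'x) ring_scheme \<Rightarrow> ('r, 'm) chain_cpx \<Rightarrow> (int \<Rightarrow> 'm \<Rightarrow> 'm) \<Rightarrow> bool" where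
  "chain_homotopy R F V \<longleftrightarrow>
     (\<forall>n. V n \<in> module_hom_set R (chain_mod F n) (chain_mod F (n + 1)))"

definition vector_field ::
  "('r, 'x) ring_scheme \<Rightarrow> ('r, 'm) chain_cpx \<Rightarrow> (int \<Rightarrow> 'm \<Rightarrow> 'm) \<Rightarrow> bool" where
  "vector_field R F V \<longleftrightarrow>
     chain_homotopy R F V \<and>
     (\<forall>n. \<forall>x\<in>carrier (chain_mod F n). V (n + 1) (V n x) = \<zero>\<^bsub>chain_mod F (n + 1 + 1)\<^esub>)"


section \<open>Stratifications\<close>

text \<open>In the following, \<open>S n a\<close> is the summand \<open>F\<^sub>n\<^sup>a\<close>, \<open>filt P F S a\<close> is the subcomplex
  \<open>F(a)\<close>, and \<open>sub_filt P F S a\<close> is the sum of all \<open>F(b)\<close> with \<open>b < a\<close>.\<close>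

definition filt ::
  "('p, 'y) gorder_scheme \<Rightarrow> ('r, 'm) chain_cpx \<Rightarrow> (int \<Rightarrow> 'p \<Rightarrow> 'm set) \<Rightarrow> 'p \<Rightarrow> int \<Rightarrow> 'm set" where
  "filt P F S a n = submodule_sum (chain_mod F n) {x \<in> carrier P. x \<sqsubseteq>\<^bsub>P\<^esub> a} (S n)"

definition sub_filt ::
  "('p, 'y) gorder_scheme \<Rightarrow> ('r, 'm) chain_cpx \<Rightarrow> (int \<Rightarrow> 'p \<Rightarrow> 'm set) \<Rightarrow> 'p \<Rightarrow> int \<Rightarrow> 'm set" where
  "sub_filt P F S a n =
     submodule_sum (chain_mod F n) {b \<in> carrier P. b \<sqsubset>\<^bsub>P\<^esub> a} (\<lambda>b. filt P F S b n)"

definition stratification ::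
  "('r, 'x) ring_scheme \<Rightarrow> ('p, 'y) gorder_scheme \<Rightarrow> ('r, 'm) chain_cpx \<Rightarrow>
   (int \<Rightarrow> 'p \<Rightarrow> 'm set) \<Rightarrow> bool" where
  "stratification R P F S \<longleftrightarrow>
     (\<forall>n. internal_direct_sum R (chain_mod F n) (carrier P) (S n)) \<and>
     (\<forall>a\<in>carrier P. subcomplex R F (filt P F S a))"

definition stratum ::
  "('p, 'y) gorder_scheme \<Rightarrow> ('r, 'm) chain_cpx \<Rightarrow> (int \<Rightarrow> 'p \<Rightarrow> 'm set) \<Rightarrow> 'p \<Rightarrow>
   ('r, 'm set) chain_cpx" where
  "stratum P F S a = quot_cpx (restrict_cpx F (filt P F S a)) (sub_filt P F S a)"

text \<open>The canonical projection of \<open>F(a)\<close> onto the stratum at \<open>a\<close>.  Its restriction to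
  \<open>F\<^sub>n\<^sup>a\<close> is the isomorphism by which the degree \<open>n\<close> part of the stratum is identified with
  \<open>F\<^sub>n\<^sup>a\<close>.\<close>

definition stratum_proj ::
  "('p, 'y) gorder_scheme \<Rightarrow> ('r, 'm) chain_cpx \<Rightarrow> (int \<Rightarrow> 'p \<Rightarrow> 'm set) \<Rightarrow> 'p \<Rightarrow>
   int \<Rightarrow> 'm \<Rightarrow> 'm set" where
  "stratum_proj P F S a n x = sub_filt P F S a n +>\<^bsub>chain_mod F n\<^esub> x"

definition compatible ::
  "('p, 'y) gorder_scheme \<Rightarrow> (int \<Rightarrow> 'p \<Rightarrow> 'm set) \<Rightarrow> (int \<Rightarrow> 'm \<Rightarrow> 'm) \<Rightarrow> bool" where
  "compatible P S V \<longleftrightarrow> (\<forall>a\<in>carrier P. \<forall>n. V n ` S n a \<subseteq> S (n + 1) a)"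

definition induced ::
  "('p, 'y) gorder_scheme \<Rightarrow> ('r, 'm) chain_cpx \<Rightarrow> (int \<Rightarrow> 'p \<Rightarrow> 'm set) \<Rightarrow> 'p \<Rightarrow>
   (int \<Rightarrow> 'm \<Rightarrow> 'm) \<Rightarrow> int \<Rightarrow> 'm set \<Rightarrow> 'm set" where
  "induced P F S a V n =
     quot_map (chain_mod F (n + 1)) (sub_filt P F S a (n + 1)) (V n)"

text \<open>Extension by zero: the linear map that corresponds to \<open>W\<close> on \<open>F\<^sub>n\<^sup>a\<close> and vanishes on
  \<open>F\<^sub>n\<^sup>b\<close> for \<open>b \<noteq> a\<close>.\<close>

definition extend_zero ::
  "('p, 'y) gorder_scheme \<Rightarrow> ('r, 'm) chain_cpx \<Rightarrow> (int \<Rightarrow> 'p \<Rightarrow> 'm set) \<Rightarrow> 'p \<Rightarrow>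
   (int \<Rightarrow> 'm set \<Rightarrow> 'm set) \<Rightarrow> int \<Rightarrow> 'm \<Rightarrow> 'm" where
  "extend_zero P F S a W n x =
     inv_into (S (n + 1) a) (stratum_proj P F S a (n + 1))
       (W n (stratum_proj P F S a n (component (chain_mod F n) (carrier P) (S n) a x)))"

definition sum_field ::
  "('p, 'y) gorder_scheme \<Rightarrow> ('r, 'm) chain_cpx \<Rightarrow> (int \<Rightarrow> 'p \<Rightarrow> 'm set) \<Rightarrow>
   ('p \<Rightarrow> int \<Rightarrow> 'm set \<Rightarrow> 'm set) \<Rightarrow> int \<Rightarrow> 'm \<Rightarrow> 'm" where
  "sum_field P F S W n x =
     finsupp_sum (chain_mod F (n + 1)) (carrier P) (\<lambda>a. extend_zero P F S a (W a) n x)"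

end

theory Submission
  imports Defs
begin

text \<open>An element of \<open>F\<^sub>n\<close> is determined by its components.  The submodule \<open>F\<^sub>n(a)\<close> consists of the
  elements supported below \<open>a\<close> and the sum of the \<open>F\<^sub>n(b)\<close>, \<open>b < a\<close>, of those supported strictly
  below \<open>a\<close>, so a coset in the stratum is the same thing as a component at \<open>a\<close>.  A compatible field
  commutes with taking components and hence descends to the strata; conversely the fields \<open>W\<^sub>a\<close> act
  on the components independently, so that each identity for \<open>W\<close> can be checked at one index \<open>a\<close>.\<close>

section \<open>Graded modules\<close>

text \<open>Finite index sets go by induction. For infinite \<open>A\<close> both sums take the
  default value zero, which \<open>h\<close> preserves.\<close>

lemma hom_add_finsum:
  assumes "abelian_group M" and "abelian_group N"
    and h: "h \<in> hom (add_monoid M) (add_monoid N)"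
    and f: "f \<in> A \<rightarrow> carrier M"
  shows "h (finsum M f A) = finsum N (\<lambda>i. h (f i)) A"
proof -
  interpret M: abelian_group M by fact
  interpret N: abelian_group N by fact
  interpret group_hom "add_monoid M" "add_monoid N" h
    using M.a_group N.a_group h by (simp add: group_hom_def group_hom_axioms_def)
  have add: "h (x \<oplus>\<^bsub>M\<^esub> y) = h x \<oplus>\<^bsub>N\<^esub> h y" if "x \<in> carrier M" "y \<in> carrier M" for x y
    using hom_mult that by simp
  have closed: "h x \<in> carrier N" if "x \<in> carrier M" for x
    using hom_closed that by simp
  have zero: "h \<zero>\<^bsub>M\<^esub> = \<zero>\<^bsub>N\<^esub>"
    using hom_one by simp
  show ?thesis
    using f
  proof (induction A rule: infinite_finite_induct)
    case (insert a A)
    then have "f \<in> A \<rightarrow> carrier M" "f a \<in> carrier M"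
      by auto
    with insert show ?case
      by (simp add: M.finsum_insert N.finsum_insert add closed Pi_iff)
  qed (simp_all add: zero)
qed

section \<open>Components of elements in an internal direct sum\<close>

locale graded_module = left_module R M
  for R :: "('r, 'x) ring_scheme" (structure) and M :: "('r, 'm) module" (structure) +
  fixes I :: "'p set" and S :: "'p \<Rightarrow> 'm set"
  assumes direct_sum: "internal_direct_sum R M I S"
begin

abbreviation comp :: "'p \<Rightarrow> 'm \<Rightarrow> 'm" where
  "comp \<equiv> component M I S"

text \<open>Phrased as vanishing outside \<open>J\<close> instead of as a sum, so that membership is
  tested one component at a time. Both \<open>filt\<close> and \<open>sub_filt\<close> turn out to
  have this form.\<close>

definition supp_in :: "'p set \<Rightarrow> 'm set" where
  "supp_in J = {x \<in> carrier M. \<forall>i\<in>I - J. comp i x = \<zero>\<^bsub>M\<^esub>}"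

lemma submodule_summand: "i \<in> I \<Longrightarrow> submodule (S i) R M"
  using direct_sum by (simp add: internal_direct_sum_def)

lemma summand_carrier: "i \<in> I \<Longrightarrow> x \<in> S i \<Longrightarrow> x \<in> carrier M"
  using submodule_summand[THEN submodule.axioms(1), THEN subgroup.subset] by auto

lemma summand_zero: "i \<in> I \<Longrightarrow> \<zero>\<^bsub>M\<^esub> \<in> S i"
  using submodule_summand[THEN submodule.axioms(1), THEN subgroup.one_closed] by auto

lemma summand_add: "i \<in> I \<Longrightarrow> x \<in> S i \<Longrightarrow> y \<in> S i \<Longrightarrow> x \<oplus>\<^bsub>M\<^esub> y \<in> S i"
  using submodule_summand[THEN submodule.axioms(1), THEN subgroup.m_closed] by auto

lemma summand_smult: "i \<in> I \<Longrightarrow> r \<in> carrier R \<Longrightarrow> x \<in> S i \<Longrightarrow> r \<odot>\<^bsub>M\<^esub> x \<in> S i"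
  using submodule_summand[THEN submodule.smult_closed] by auto

lemma smult_hom: "r \<in> carrier R \<Longrightarrow> (\<lambda>x. r \<odot>\<^bsub>M\<^esub> x) \<in> hom (add_monoid M) (add_monoid M)"
  by (auto simp: hom_def smult_r_distr)

lemma finsupp_sum_eq_finsum:
  assumes "finite A" "A \<subseteq> I" "\<And>i. i \<in> I - A \<Longrightarrow> f i = \<zero>\<^bsub>M\<^esub>" "f \<in> A \<rightarrow> carrier M"
  shows "finsupp_sum M I f = finsum M f A"
  unfolding finsupp_sum_def
  using assms by (intro M.add.finprod_mono_neutral_cong_left) auto

lemma decomposition_component:
  assumes "x \<in> carrier M"
  shows "is_decomposition M I S x (\<lambda>i. comp i x)"
proof -
  have "\<exists>!f. is_decomposition M I S x f"
    using direct_sum assms by (simp add: internal_direct_sum_def)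
  then show ?thesis
    unfolding component_def by (rule theI')
qed

lemma component_mem: "x \<in> carrier M \<Longrightarrow> i \<in> I \<Longrightarrow> comp i x \<in> S i"
  using decomposition_component unfolding is_decomposition_def by blast

lemma component_carrier: "x \<in> carrier M \<Longrightarrow> i \<in> I \<Longrightarrow> comp i x \<in> carrier M"
  using component_mem summand_carrier by blast

lemma finite_support: "x \<in> carrier M \<Longrightarrow> finite {i \<in> I. comp i x \<noteq> \<zero>\<^bsub>M\<^esub>}"
  using decomposition_component unfolding is_decomposition_def by blast

lemma finsum_component:
  assumes "x \<in> carrier M" "finite A" "A \<subseteq> I" "\<And>i. i \<in> I - A \<Longrightarrow> comp i x = \<zero>\<^bsub>M\<^esub>"
  shows "x = finsum M (\<lambda>i. comp i x) A"
proof -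
  have "finsupp_sum M I (\<lambda>i. comp i x) = finsum M (\<lambda>i. comp i x) A"
    using assms component_carrier by (intro finsupp_sum_eq_finsum) auto
  then show ?thesis
    using decomposition_component[OF assms(1)] by (simp add: is_decomposition_def)
qed

text \<open>Uniqueness of decompositions: a finitely supported choice of elements from the summands
  is itself a decomposition of its sum.\<close>

lemma component_finsupp_sum:
  assumes f: "\<And>i. i \<in> I \<Longrightarrow> f i \<in> S i" and fin: "finite {i \<in> I. f i \<noteq> \<zero>\<^bsub>M\<^esub>}"
  shows "finsupp_sum M I f \<in> carrier M"
    and "i \<in> I \<Longrightarrow> comp i (finsupp_sum M I f) = f i"
proof -
  \<comment> \<open>Decompositions are extensional functions on \<open>I\<close>, so
    \<open>f\<close> is restricted before uniqueness is applied.\<close>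
  let ?x = "finsupp_sum M I f" and ?g = "restrict f I"
  show x: "?x \<in> carrier M"
    unfolding finsupp_sum_def using f summand_carrier by (intro M.finsum_closed) auto
  have supp: "{i \<in> I. ?g i \<noteq> \<zero>\<^bsub>M\<^esub>} = {i \<in> I. f i \<noteq> \<zero>\<^bsub>M\<^esub>}"
    by auto
  have "finsupp_sum M I ?g = ?x"
    unfolding finsupp_sum_def supp
    using f summand_carrier by (intro M.finsum_cong') auto
  then have "is_decomposition M I S ?x ?g"
    using f fin supp unfolding is_decomposition_def by auto
  moreover have "\<exists>!f. is_decomposition M I S ?x f"
    using direct_sum x by (simp add: internal_direct_sum_def)
  ultimately have "(\<lambda>i. comp i ?x) = ?g"
    using decomposition_component[OF x] by blast
  then show "comp i ?x = f i" if "i \<in> I"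
    using that by (metis restrict_apply')
qed

lemma component_finsum:
  assumes "finite A" "A \<subseteq> I" "\<And>i. i \<in> A \<Longrightarrow> f i \<in> S i" "i \<in> I"
  shows "comp i (finsum M f A) = (if i \<in> A then f i else \<zero>\<^bsub>M\<^esub>)"
proof -
  \<comment> \<open>Extension by zero off \<open>A\<close> turns the finite sum into a finitely
    supported one over all of \<open>I\<close>.\<close>
  let ?g = "\<lambda>i. if i \<in> A then f i else \<zero>\<^bsub>M\<^esub>"
  have carr: "f \<in> A \<rightarrow> carrier M"
    using assms(2,3) summand_carrier by auto
  have "finsupp_sum M I ?g = finsum M ?g A"
    using assms carr by (intro finsupp_sum_eq_finsum) auto
  also have "\<dots> = finsum M f A"
    using carr by (intro M.finsum_cong') auto
  finally have eq: "finsupp_sum M I ?g = finsum M f A" .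
  have "finite {i \<in> I. ?g i \<noteq> \<zero>\<^bsub>M\<^esub>}"
    using assms(1) by (rule rev_finite_subset) auto
  then show ?thesis
    using component_finsupp_sum(2)[of ?g i] assms(3,4) summand_zero unfolding eq by auto
qed

lemma component_same: "i \<in> I \<Longrightarrow> x \<in> S i \<Longrightarrow> comp i x = x"
  using component_finsum[of "{i}" "\<lambda>_. x" i] by (simp add: M.finsum_insert summand_carrier)

lemma component_other: "i \<in> I \<Longrightarrow> j \<in> I \<Longrightarrow> i \<noteq> j \<Longrightarrow> x \<in> S j \<Longrightarrow> comp i x = \<zero>\<^bsub>M\<^esub>"
  using component_finsum[of "{j}" "\<lambda>_. x" i] by (simp add: M.finsum_insert summand_carrier)

lemma component_zero: "i \<in> I \<Longrightarrow> comp i \<zero>\<^bsub>M\<^esub> = \<zero>\<^bsub>M\<^esub>"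
  using component_same summand_zero by blast

lemma component_add:
  assumes "x \<in> carrier M" "y \<in> carrier M" "i \<in> I"
  shows "comp i (x \<oplus>\<^bsub>M\<^esub> y) = comp i x \<oplus>\<^bsub>M\<^esub> comp i y"
proof -
  \<comment> \<open>A common finite index set over which both \<open>x\<close> and \<open>y\<close>
    are the sums of their components.\<close>
  define A where "A = {i \<in> I. comp i x \<noteq> \<zero>\<^bsub>M\<^esub>} \<union> {i \<in> I. comp i y \<noteq> \<zero>\<^bsub>M\<^esub>}"
  have A: "finite A" "A \<subseteq> I"
    using finite_support assms by (auto simp: A_def)
  have zero: "comp i x = \<zero>\<^bsub>M\<^esub>" "comp i y = \<zero>\<^bsub>M\<^esub>" if "i \<in> I - A" for i
    using that by (auto simp: A_def)
  have "finsum M (\<lambda>i. comp i x \<oplus>\<^bsub>M\<^esub> comp i y) A = x \<oplus>\<^bsub>M\<^esub> y"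
    using A assms zero finsum_component[of _ A] component_carrier
    by (subst M.finsum_addf) (auto simp: subset_iff)
  moreover have "comp i (finsum M (\<lambda>i. comp i x \<oplus>\<^bsub>M\<^esub> comp i y) A) =
      (if i \<in> A then comp i x \<oplus>\<^bsub>M\<^esub> comp i y else \<zero>\<^bsub>M\<^esub>)"
    using A assms component_mem summand_add by (intro component_finsum) auto
  ultimately show ?thesis
    using zero assms by auto
qed

text \<open>Each element is the sum of its components. This is the principle by which identities are
  later reduced to a single index.\<close>

lemma component_eqI:
  assumes "x \<in> carrier M" "y \<in> carrier M" "\<And>i. i \<in> I \<Longrightarrow> comp i x = comp i y"
  shows "x = y"
proof -
  \<comment> \<open>As the components agree, the support of \<open>x\<close> is also that of
    \<open>y\<close>, so one index set serves for both expansions.\<close>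
  let ?A = "{i \<in> I. comp i x \<noteq> \<zero>\<^bsub>M\<^esub>}"
  have "x = finsum M (\<lambda>i. comp i x) ?A"
    using assms finite_support by (intro finsum_component) auto
  also have "\<dots> = finsum M (\<lambda>i. comp i y) ?A"
    using assms component_carrier by (intro M.finsum_cong') auto
  also have "\<dots> = y"
    using assms finite_support by (intro finsum_component[symmetric]) auto
  finally show ?thesis .
qed

text \<open>Under the hypothesis \<open>x\<close> and \<open>comp i x\<close> have the same
  components, hence are equal, and the latter lies in \<open>S i\<close>.\<close>

lemma mem_summandI:
  assumes "x \<in> carrier M" "i \<in> I" "\<And>j. j \<in> I \<Longrightarrow> j \<noteq> i \<Longrightarrow> comp j x = \<zero>\<^bsub>M\<^esub>"
  shows "x \<in> S i"
proof -
  have "comp j (comp i x) = comp j x" if "j \<in> I" for j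
    using assms that component_mem[of x i] component_same[of i] component_other[of j i]
    by (cases "j = i") auto
  then have "comp i x = x"
    by (rule component_eqI[OF component_carrier[OF assms(1,2)] assms(1)])
  then show ?thesis
    using component_mem[OF assms(1,2)] by simp
qed

section \<open>Submodules cut out by a support condition, and their cosets\<close>

lemma supp_in_mono: "J \<subseteq> K \<Longrightarrow> supp_in J \<subseteq> supp_in K"
  by (auto simp: supp_in_def)

lemma supp_in_zero: "\<zero>\<^bsub>M\<^esub> \<in> supp_in J"
  by (simp add: supp_in_def component_zero)

lemma supp_in_add: "x \<in> supp_in J \<Longrightarrow> y \<in> supp_in J \<Longrightarrow> x \<oplus>\<^bsub>M\<^esub> y \<in> supp_in J"
  by (simp add: supp_in_def component_add)

lemma summand_supp_in: "i \<in> I \<Longrightarrow> i \<in> J \<Longrightarrow> S i \<subseteq> supp_in J"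
  using component_other summand_carrier by (fastforce simp: supp_in_def)

lemma supp_in_finsum:
  assumes "f \<in> A \<rightarrow> supp_in J"
  shows "finsum M f A \<in> supp_in J"
  using assms
proof (induction A rule: infinite_finite_induct)
  case (insert a A)
  then have "f \<in> A \<rightarrow> carrier M" "f a \<in> carrier M"
    by (auto simp: supp_in_def)
  with insert show ?case
    by (simp add: M.finsum_insert supp_in_add)
qed (simp_all add: supp_in_zero)

text \<open>The family \<open>T\<close> may be anything between the summands and the whole of
  \<open>supp_in J\<close>. This covers \<open>filt\<close>, where \<open>T\<close> consists of the
  summands, and \<open>sub_filt\<close>, where it consists of the submodules \<open>filt\<close> at
  smaller indices.\<close>

lemma submodule_sum_eq_supp_in:
  assumes J: "J \<subseteq> I" and T: "\<And>j. j \<in> J \<Longrightarrow> S j \<subseteq> T j" "\<And>j. j \<in> J \<Longrightarrow> T j \<subseteq> supp_in J"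
  shows "submodule_sum M J T = supp_in J"
proof
  show "submodule_sum M J T \<subseteq> supp_in J"
    using T(2) by (fastforce simp: submodule_sum_def intro!: supp_in_finsum)
  show "supp_in J \<subseteq> submodule_sum M J T"
  proof
    fix x assume x: "x \<in> supp_in J"
    let ?A = "{i \<in> I. comp i x \<noteq> \<zero>\<^bsub>M\<^esub>}"
    have carr: "x \<in> carrier M" and sub: "?A \<subseteq> J"
      using x by (auto simp: supp_in_def)
    have "x = finsum M (\<lambda>i. comp i x) ?A"
      using carr finite_support by (intro finsum_component) auto
    moreover have "(\<lambda>i. comp i x) \<in> (\<Pi> i\<in>?A. T i)"
      using component_mem[OF carr] T(1) sub by blast
    ultimately show "x \<in> submodule_sum M J T"
      using finite_support[OF carr] sub unfolding submodule_sum_def by blast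
  qed
qed

text \<open>Two elements are congruent exactly when their difference is supported in
  \<open>J\<close>, that is, when their components outside \<open>J\<close> agree. Equality of
  cosets thereby becomes a comparison of components.\<close>

lemma coset_supp_in:
  assumes "x \<in> carrier M"
  shows "supp_in J +>\<^bsub>M\<^esub> x = {y \<in> carrier M. \<forall>i\<in>I - J. comp i y = comp i x}"
proof (intro equalityI subsetI)
  fix y assume "y \<in> supp_in J +>\<^bsub>M\<^esub> x"
  then show "y \<in> {y \<in> carrier M. \<forall>i\<in>I - J. comp i y = comp i x}"
    using assms component_carrier
    by (auto simp: a_r_coset_def' supp_in_def component_add)
next
  fix y assume y: "y \<in> {y \<in> carrier M. \<forall>i\<in>I - J. comp i y = comp i x}"
  define z where "z = y \<ominus>\<^bsub>M\<^esub> x"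
  have z: "z \<in> carrier M" "y = z \<oplus>\<^bsub>M\<^esub> x"
    using y assms by (auto simp: z_def a_minus_def M.a_assoc M.l_neg)
  have "comp i z = \<zero>\<^bsub>M\<^esub>" if "i \<in> I - J" for i
  proof -
    have "comp i z \<oplus>\<^bsub>M\<^esub> comp i x = comp i x"
      using y that component_add[OF z(1) assms, of i] z(2) by simp
    then show ?thesis
      using z assms that component_carrier M.add.r_cancel_one by simp
  qed
  then have "z \<in> supp_in J"
    using z by (simp add: supp_in_def)
  then show "y \<in> supp_in J +>\<^bsub>M\<^esub> x"
    using z by (auto simp: a_r_coset_def')
qed

lemma set_add_coset_supp_in:
  assumes "x \<in> carrier M" "y \<in> carrier M"
  shows "(supp_in J +>\<^bsub>M\<^esub> x) <+>\<^bsub>M\<^esub> (supp_in J +>\<^bsub>M\<^esub> y) = supp_in J +>\<^bsub>M\<^esub> (x \<oplus>\<^bsub>M\<^esub> y)"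
proof (intro equalityI subsetI)
  fix u assume "u \<in> (supp_in J +>\<^bsub>M\<^esub> x) <+>\<^bsub>M\<^esub> (supp_in J +>\<^bsub>M\<^esub> y)"
  then show "u \<in> supp_in J +>\<^bsub>M\<^esub> (x \<oplus>\<^bsub>M\<^esub> y)"
    using assms by (auto simp: coset_supp_in set_add_def' component_add)
next
  fix u assume "u \<in> supp_in J +>\<^bsub>M\<^esub> (x \<oplus>\<^bsub>M\<^esub> y)"
  then obtain z where z: "z \<in> supp_in J" "u = z \<oplus>\<^bsub>M\<^esub> (x \<oplus>\<^bsub>M\<^esub> y)"
    by (auto simp: a_r_coset_def')
  \<comment> \<open>The element \<open>z\<close> of the submodule is absorbed into the
    representative of the first coset.\<close>
  then have "u = (z \<oplus>\<^bsub>M\<^esub> x) \<oplus>\<^bsub>M\<^esub> y"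
    using assms by (simp add: supp_in_def M.a_assoc)
  moreover have "z \<oplus>\<^bsub>M\<^esub> x \<in> supp_in J +>\<^bsub>M\<^esub> x"
    using z by (auto simp: a_r_coset_def')
  moreover have "y \<in> supp_in J +>\<^bsub>M\<^esub> y"
    using assms by (simp add: coset_supp_in)
  ultimately show "u \<in> (supp_in J +>\<^bsub>M\<^esub> x) <+>\<^bsub>M\<^esub> (supp_in J +>\<^bsub>M\<^esub> y)"
    by (auto simp: set_add_def')
qed

end

section \<open>Additive maps that preserve the grading\<close>

locale graded_map = M: graded_module R M I S + N: graded_module R N I T
  for R :: "('r, 'x) ring_scheme" and M :: "('r, 'm) module" and N :: "('r, 'n) module"
    and I :: "'p set" and S T +
  fixes h :: "'m \<Rightarrow> 'n"
  assumes hom: "h \<in> hom (add_monoid M) (add_monoid N)"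
    and graded: "\<And>i x. i \<in> I \<Longrightarrow> x \<in> S i \<Longrightarrow> h x \<in> T i"
begin

lemma map_closed: "x \<in> carrier M \<Longrightarrow> h x \<in> carrier N"
  using hom by (auto simp: hom_def)

lemma component_map:
  assumes x: "x \<in> carrier M" and i: "i \<in> I"
  shows "N.comp i (h x) = h (M.comp i x)"
proof -
  \<comment> \<open>The index \<open>i\<close> is inserted so that it occurs in the sum even when
    the component of \<open>x\<close> there is zero.\<close>
  let ?A = "insert i {i \<in> I. M.comp i x \<noteq> \<zero>\<^bsub>M\<^esub>}"
  have A: "finite ?A" "?A \<subseteq> I"
    using M.finite_support[OF x] i by auto
  have "h x = h (finsum M (\<lambda>i. M.comp i x) ?A)"
    using A x by (intro arg_cong[where f = h] M.finsum_component) auto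
  also have "\<dots> = finsum N (\<lambda>i. h (M.comp i x)) ?A"
    using A x M.component_carrier hom
    by (intro hom_add_finsum M.M.abelian_group_axioms N.M.abelian_group_axioms) auto
  finally have "h x = finsum N (\<lambda>i. h (M.comp i x)) ?A" .
  then show ?thesis
    using N.component_finsum[OF A, of "\<lambda>i. h (M.comp i x)" i] A x i graded M.component_mem
    by (auto simp: subset_iff)
qed

lemma map_zero: "h \<zero>\<^bsub>M\<^esub> = \<zero>\<^bsub>N\<^esub>"
  \<comment> \<open>Zero is the empty sum, so this is the case of no summands.\<close>
  using hom_add_finsum[OF M.M.abelian_group_axioms N.M.abelian_group_axioms hom, of undefined "{}"]
  by simp

lemma map_supp_in: "x \<in> M.supp_in J \<Longrightarrow> h x \<in> N.supp_in J"
  by (auto simp: M.supp_in_def N.supp_in_def component_map map_closed map_zero)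

text \<open>The union defining \<open>quot_map\<close> runs over all representatives. Since
  \<open>h\<close> commutes with components, they all yield the same coset, and \<open>x\<close>
  itself is one of them.\<close>

lemma quot_map_coset:
  assumes x: "x \<in> carrier M"
  shows "quot_map N (N.supp_in J) h (M.supp_in J +>\<^bsub>M\<^esub> x) = N.supp_in J +>\<^bsub>N\<^esub> h x"
proof -
  have "N.supp_in J +>\<^bsub>N\<^esub> h y = N.supp_in J +>\<^bsub>N\<^esub> h x" if "y \<in> M.supp_in J +>\<^bsub>M\<^esub> x" for y
    using that x by (auto simp: M.coset_supp_in N.coset_supp_in map_closed component_map)
  moreover have "x \<in> M.supp_in J +>\<^bsub>M\<^esub> x"
    using x by (simp add: M.coset_supp_in)
  ultimately show ?thesis
    unfolding quot_map_def by blast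
qed

end

context graded_module
begin

text \<open>Over a noncommutative ring multiplication by \<open>r\<close> is additive but need not
  be linear, which is why \<open>graded_map\<close> asks for an additive map only. The facts on
  scalars and components, supports or cosets become instances of those on graded maps.\<close>

lemma graded_map_smult:
  "r \<in> carrier R \<Longrightarrow> graded_map R M M I S S (\<lambda>x. r \<odot>\<^bsub>M\<^esub> x)"
  by (intro graded_map.intro graded_map_axioms.intro graded_module_axioms smult_hom summand_smult)

lemma component_smult:
  "r \<in> carrier R \<Longrightarrow> x \<in> carrier M \<Longrightarrow> i \<in> I \<Longrightarrow> comp i (r \<odot>\<^bsub>M\<^esub> x) = r \<odot>\<^bsub>M\<^esub> comp i x"
  using graded_map.component_map[OF graded_map_smult] .

lemma supp_in_smult: "r \<in> carrier R \<Longrightarrow> x \<in> supp_in J \<Longrightarrow> r \<odot>\<^bsub>M\<^esub> x \<in> supp_in J"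
  using graded_map.map_supp_in[OF graded_map_smult] .

end

lemma module_hom_setD:
  assumes "h \<in> module_hom_set R M N"
  shows "x \<in> carrier M \<Longrightarrow> h x \<in> carrier N"
    and "x \<in> carrier M \<Longrightarrow> y \<in> carrier M \<Longrightarrow> h (x \<oplus>\<^bsub>M\<^esub> y) = h x \<oplus>\<^bsub>N\<^esub> h y"
    and "r \<in> carrier R \<Longrightarrow> x \<in> carrier M \<Longrightarrow> h (r \<odot>\<^bsub>M\<^esub> x) = r \<odot>\<^bsub>N\<^esub> h x"
  using assms by (auto simp: module_hom_set_def hom_def)

lemma module_hom_setI:
  assumes "\<And>x. x \<in> carrier M \<Longrightarrow> h x \<in> carrier N"
    and "\<And>x y. x \<in> carrier M \<Longrightarrow> y \<in> carrier M \<Longrightarrow> h (x \<oplus>\<^bsub>M\<^esub> y) = h x \<oplus>\<^bsub>N\<^esub> h y"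
    and "\<And>r x. r \<in> carrier R \<Longrightarrow> x \<in> carrier M \<Longrightarrow> h (r \<odot>\<^bsub>M\<^esub> x) = r \<odot>\<^bsub>N\<^esub> h x"
  shows "h \<in> module_hom_set R M N"
  using assms by (auto simp: module_hom_set_def hom_def)

section \<open>Strata as graded pieces\<close>

locale stratified_complex = partial_order P
  for R :: "('r, 'x) ring_scheme" and P :: "('p, 'y) gorder_scheme"
    and F :: "('r, 'm) chain_cpx" and S :: "int \<Rightarrow> 'p \<Rightarrow> 'm set" +
  assumes complex: "chain_complex R F"
    and strat: "stratification R P F S"
begin

abbreviation below :: "'p \<Rightarrow> 'p set" where
  "below a \<equiv> {x \<in> carrier P. x \<sqsubseteq>\<^bsub>P\<^esub> a}"

abbreviation strictly_below :: "'p \<Rightarrow> 'p set" where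
  "strictly_below a \<equiv> {x \<in> carrier P. x \<sqsubset>\<^bsub>P\<^esub> a}"

abbreviation comp :: "int \<Rightarrow> 'p \<Rightarrow> 'm \<Rightarrow> 'm" where
  "comp n \<equiv> component (chain_mod F n) (carrier P) (S n)"

abbreviation proj :: "'p \<Rightarrow> int \<Rightarrow> 'm \<Rightarrow> 'm set" where
  "proj \<equiv> stratum_proj P F S"

abbreviation str :: "'p \<Rightarrow> int \<Rightarrow> ('r, 'm set) module" where
  "str a \<equiv> chain_mod (stratum P F S a)"

end

sublocale stratified_complex \<subseteq> deg: graded_module R "chain_mod F n" "carrier P" "S n" for n
  using complex strat
  by (simp add: graded_module_def graded_module_axioms_def chain_complex_def stratification_def)

context stratified_complex
begin

section \<open>The filtration expressed through supports\<close>

lemma lless_iff: "a \<in> carrier P \<Longrightarrow> b \<in> carrier P \<Longrightarrow> b \<sqsubset>\<^bsub>P\<^esub> a \<longleftrightarrow> b \<sqsubseteq>\<^bsub>P\<^esub> a \<and> b \<noteq> a"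
  by (simp add: lless_def eq_is_equal)

lemma filt_eq: "filt P F S a n = deg.supp_in n (below a)"
  unfolding filt_def
  by (intro deg.submodule_sum_eq_supp_in deg.summand_supp_in) auto

lemma sub_filt_eq:
  assumes "a \<in> carrier P"
  shows "sub_filt P F S a n = deg.supp_in n (strictly_below a)"
  unfolding sub_filt_def
proof (rule deg.submodule_sum_eq_supp_in)
  fix b assume b: "b \<in> strictly_below a"
  then show "S n b \<subseteq> filt P F S b n"
    unfolding filt_eq by (intro deg.summand_supp_in) auto
  \<comment> \<open>Transitivity gives that the index lies below \<open>a\<close>; antisymmetry
    excludes \<open>a\<close> itself.\<close>
  have "below b \<subseteq> strictly_below a"
    using assms b by (auto simp: lless_iff intro: le_trans)
  then show "filt P F S b n \<subseteq> deg.supp_in n (strictly_below a)"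
    unfolding filt_eq by (rule deg.supp_in_mono)
qed auto

lemma filt_carrier: "x \<in> filt P F S a n \<Longrightarrow> x \<in> carrier (chain_mod F n)"
  by (simp add: filt_eq deg.supp_in_def)

lemma summand_filt: "a \<in> carrier P \<Longrightarrow> x \<in> S n a \<Longrightarrow> x \<in> filt P F S a n"
  using deg.summand_supp_in[of a "below a" n] by (auto simp: filt_eq)

lemma component_filt:
  "a \<in> carrier P \<Longrightarrow> x \<in> carrier (chain_mod F n) \<Longrightarrow> comp n a x \<in> filt P F S a n"
  by (intro summand_filt deg.component_mem)

section \<open>Elements of a stratum as components at its index\<close>

lemma proj_eq:
  "a \<in> carrier P \<Longrightarrow> proj a n x = deg.supp_in n (strictly_below a) +>\<^bsub>chain_mod F n\<^esub> x"
  by (simp add: stratum_proj_def sub_filt_eq)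

lemma stratum_carrier: "carrier (str a n) = proj a n ` filt P F S a n"
  by (auto simp: stratum_def quot_cpx_def restrict_cpx_def quot_module_def A_RCOSETS_def'
      stratum_proj_def a_r_coset_def')

lemma proj_closed: "x \<in> filt P F S a n \<Longrightarrow> proj a n x \<in> carrier (str a n)"
  by (simp add: stratum_carrier)

lemma stratum_add:
  assumes "a \<in> carrier P" "x \<in> carrier (chain_mod F n)" "y \<in> carrier (chain_mod F n)"
  shows "proj a n x \<oplus>\<^bsub>str a n\<^esub> proj a n y = proj a n (x \<oplus>\<^bsub>chain_mod F n\<^esub> y)"
  using deg.set_add_coset_supp_in[OF assms(2,3)] assms(1)
  by (simp add: stratum_def quot_cpx_def restrict_cpx_def quot_module_def set_add_def' proj_eq)

lemma stratum_smult:
  assumes "a \<in> carrier P" "r \<in> carrier R" "x \<in> carrier (chain_mod F n)"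
  shows "r \<odot>\<^bsub>str a n\<^esub> proj a n x = proj a n (r \<odot>\<^bsub>chain_mod F n\<^esub> x)"
  using graded_map.quot_map_coset[OF deg.graded_map_smult[OF assms(2)] assms(3)] assms(1)
  by (simp add: stratum_def quot_cpx_def restrict_cpx_def quot_module_def proj_eq sub_filt_eq
      quot_map_def a_r_coset_def')

text \<open>The quotient record stores the submodule itself as its zero; written as a projection it
  fits the other rules for \<open>proj\<close>.\<close>

lemma stratum_zero:
  assumes "a \<in> carrier P"
  shows "\<zero>\<^bsub>str a n\<^esub> = proj a n \<zero>\<^bsub>chain_mod F n\<^esub>"
proof -
  have "\<zero>\<^bsub>str a n\<^esub> = deg.supp_in n (strictly_below a)"
    by (simp add: stratum_def quot_cpx_def quot_module_def sub_filt_eq assms)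
  then show ?thesis
    by (auto simp: proj_eq assms deg.coset_supp_in deg.supp_in_def deg.component_zero)
qed

text \<open>Congruence means agreement at all indices not strictly below \<open>a\<close>. Within
  \<open>filt\<close> the components at indices not below \<open>a\<close> vanish, so only the one
  at \<open>a\<close> is left to compare.\<close>

lemma proj_eq_iff:
  assumes a: "a \<in> carrier P" and x: "x \<in> filt P F S a n" and y: "y \<in> filt P F S a n"
  shows "proj a n x = proj a n y \<longleftrightarrow> comp n a x = comp n a y"
proof
  assume "proj a n x = proj a n y"
  then have "x \<in> proj a n y"
    using a x by (auto simp: proj_eq deg.coset_supp_in filt_carrier)
  then show "comp n a x = comp n a y"
    using a y by (auto simp: proj_eq deg.coset_supp_in filt_carrier lless_iff)
next
  assume eq: "comp n a x = comp n a y"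
  have "comp n i x = comp n i y" if "i \<in> carrier P - strictly_below a" for i
  proof (cases "i = a")
    case False
    then have "i \<notin> below a"
      using a that by (auto simp: lless_iff)
    then show ?thesis
      using x y that by (simp add: filt_eq deg.supp_in_def)
  qed (simp add: eq)
  then show "proj a n x = proj a n y"
    using a x y by (auto simp: proj_eq deg.coset_supp_in filt_carrier)
qed

lemma proj_component:
  "a \<in> carrier P \<Longrightarrow> x \<in> filt P F S a n \<Longrightarrow> proj a n (comp n a x) = proj a n x"
  by (simp add: proj_eq_iff component_filt filt_carrier deg.component_same deg.component_mem)

text \<open>The identification of the stratum in degree \<open>n\<close> with the summand: the
  component at \<open>a\<close> of any representative is the unique representative in
  \<open>S n a\<close>.\<close>

lemma bij_betw_proj:
  assumes "a \<in> carrier P"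
  shows "bij_betw (proj a n) (S n a) (carrier (str a n))"
proof (rule bij_betw_imageI)
  show "inj_on (proj a n) (S n a)"
    using assms by (intro inj_onI) (simp add: proj_eq_iff summand_filt deg.component_same)
  show "proj a n ` S n a = carrier (str a n)"
  proof (intro equalityI subsetI)
    fix X assume "X \<in> carrier (str a n)"
    then obtain x where x: "x \<in> filt P F S a n" "X = proj a n x"
      by (auto simp: stratum_carrier)
    then have "X = proj a n (comp n a x)" "comp n a x \<in> S n a"
      using assms by (simp_all add: proj_component deg.component_mem filt_carrier)
    then show "X \<in> proj a n ` S n a"
      by blast
  qed (auto intro: proj_closed summand_filt[OF assms])
qed

text \<open>Linearity is checked on representatives in \<open>filt\<close>, through which both the
  operations of the stratum and the map \<open>g\<close> are computed.\<close>

lemma stratum_homI: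
  assumes a: "a \<in> carrier P"
    and h: "h \<in> module_hom_set R (chain_mod F n) (chain_mod F m)"
    and filt: "\<And>x. x \<in> filt P F S a n \<Longrightarrow> h x \<in> filt P F S a m"
    and proj: "\<And>x. x \<in> filt P F S a n \<Longrightarrow> g (proj a n x) = proj a m (h x)"
  shows "g \<in> module_hom_set R (str a n) (str a m)"
proof (rule module_hom_setI)
  fix X assume "X \<in> carrier (str a n)"
  then obtain x where x: "x \<in> filt P F S a n" "X = proj a n x"
    by (auto simp: stratum_carrier)
  then show "g X \<in> carrier (str a m)"
    by (simp add: proj filt proj_closed)
  show "g (r \<odot>\<^bsub>str a n\<^esub> X) = r \<odot>\<^bsub>str a m\<^esub> g X" if r: "r \<in> carrier R" for r
  proof -
    have "r \<odot>\<^bsub>chain_mod F n\<^esub> x \<in> filt P F S a n"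
      using x r by (simp add: filt_eq deg.supp_in_smult)
    then show ?thesis
      using x a r module_hom_setD[OF h]
      by (simp add: stratum_smult proj filt_carrier)
  qed
  fix Y assume "Y \<in> carrier (str a n)"
  then obtain y where y: "y \<in> filt P F S a n" "Y = proj a n y"
    by (auto simp: stratum_carrier)
  have "x \<oplus>\<^bsub>chain_mod F n\<^esub> y \<in> filt P F S a n"
    using x y by (simp add: filt_eq deg.supp_in_add)
  then show "g (X \<oplus>\<^bsub>str a n\<^esub> Y) = g X \<oplus>\<^bsub>str a m\<^esub> g Y"
    using x y a module_hom_setD[OF h]
    by (simp add: stratum_add proj filt_carrier)
qed

section \<open>Compatible fields and the fields they induce on strata\<close>

lemma graded_map_compatible:
  assumes "vector_field R F V" "compatible P S V"
  shows "graded_map R (chain_mod F n) (chain_mod F (n + 1)) (carrier P) (S n) (S (n + 1)) (V n)"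
proof (intro graded_map.intro graded_map_axioms.intro deg.graded_module_axioms)
  show "V n \<in> hom (add_monoid (chain_mod F n)) (add_monoid (chain_mod F (n + 1)))"
    using assms(1) by (simp add: vector_field_def chain_homotopy_def module_hom_set_def)
qed (use assms(2) in \<open>auto simp: compatible_def\<close>)

lemma compatible_filt:
  assumes "vector_field R F V" "compatible P S V" "x \<in> filt P F S a n"
  shows "V n x \<in> filt P F S a (n + 1)"
  using graded_map.map_supp_in[OF graded_map_compatible[OF assms(1,2)]] assms(3)
  by (simp add: filt_eq)

lemma induced_proj:
  assumes "vector_field R F V" "compatible P S V" "a \<in> carrier P" "x \<in> filt P F S a n"
  shows "induced P F S a V n (proj a n x) = proj a (n + 1) (V n x)"
  using graded_map.quot_map_coset[OF graded_map_compatible[OF assms(1,2)]] assms(3,4)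
  by (simp add: induced_def proj_eq sub_filt_eq filt_carrier)

text \<open>The induced map acts through any representative in \<open>filt\<close>, and
  \<open>V\<close> keeps such representatives in \<open>filt\<close>; linearity and square zero are
  thus inherited from \<open>V\<close>.\<close>

lemma vector_field_induced:
  assumes V: "vector_field R F V" "compatible P S V" and a: "a \<in> carrier P"
  shows "vector_field R (stratum P F S a) (induced P F S a V)"
  unfolding vector_field_def chain_homotopy_def
proof (intro conjI allI ballI)
  fix n
  show "induced P F S a V n \<in> module_hom_set R (str a n) (str a (n + 1))"
    using V a by (intro stratum_homI[where h = "V n"] compatible_filt induced_proj)
      (auto simp: vector_field_def chain_homotopy_def)
  fix X assume "X \<in> carrier (str a n)"
  then obtain x where x: "x \<in> filt P F S a n" "X = proj a n x"
    by (auto simp: stratum_carrier)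
  then have "V (n + 1) (V n x) = \<zero>\<^bsub>chain_mod F (n + 1 + 1)\<^esub>"
    using V filt_carrier by (auto simp: vector_field_def)
  then show "induced P F S a V (n + 1) (induced P F S a V n X) = \<zero>\<^bsub>str a (n + 1 + 1)\<^esub>"
    using x V a by (simp add: induced_proj compatible_filt stratum_zero)
qed

end

section \<open>Extension and summation of fields on the strata\<close>

locale stratum_field = stratified_complex R P F S
  for R :: "('r, 'x) ring_scheme" and P :: "('p, 'y) gorder_scheme"
    and F :: "('r, 'm) chain_cpx" and S :: "int \<Rightarrow> 'p \<Rightarrow> 'm set" +
  fixes a :: 'p and W :: "int \<Rightarrow> 'm set \<Rightarrow> 'm set"
  assumes a: "a \<in> carrier P" and W: "vector_field R (stratum P F S a) W"
begin

abbreviation ext :: "int \<Rightarrow> 'm \<Rightarrow> 'm" where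
  "ext \<equiv> extend_zero P F S a W"

lemma W_hom: "W n \<in> module_hom_set R (str a n) (str a (n + 1))"
  using W by (simp add: vector_field_def chain_homotopy_def)

lemma proj_component_closed:
  "x \<in> carrier (chain_mod F n) \<Longrightarrow> proj a n (comp n a x) \<in> carrier (str a n)"
  by (simp add: proj_closed component_filt a)

text \<open>Injectivity of the projection on the summand characterises the value of
  \<open>ext\<close>. Identities for \<open>ext\<close> are therefore verified in the stratum, where
  the properties of \<open>W\<close> apply.\<close>

lemma ext_eqI:
  assumes "y \<in> S (n + 1) a" "proj a (n + 1) y = W n (proj a n (comp n a x))"
  shows "ext n x = y"
  unfolding extend_zero_def
  using assms bij_betw_imp_inj_on[OF bij_betw_proj[OF a]] by (intro inv_into_f_eq) auto

text \<open>The value of \<open>W n\<close> lies in the stratum, each element of which has a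
  representative in the summand at \<open>a\<close>; hence the \<open>inv_into\<close> in
  \<open>extend_zero\<close> is a genuine inverse here.\<close>

lemma
  assumes x: "x \<in> carrier (chain_mod F n)"
  shows ext_mem: "ext n x \<in> S (n + 1) a"
    and proj_ext: "proj a (n + 1) (ext n x) = W n (proj a n (comp n a x))"
proof -
  have "W n (proj a n (comp n a x)) \<in> proj a (n + 1) ` S (n + 1) a"
    using module_hom_setD(1)[OF W_hom proj_component_closed[OF x]]
      bij_betw_imp_surj_on[OF bij_betw_proj[OF a]] by simp
  then show "ext n x \<in> S (n + 1) a"
    and "proj a (n + 1) (ext n x) = W n (proj a n (comp n a x))"
    unfolding extend_zero_def by (rule inv_into_into, rule f_inv_into_f)
qed

lemma ext_carrier: "x \<in> carrier (chain_mod F n) \<Longrightarrow> ext n x \<in> carrier (chain_mod F (n + 1))"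
  using ext_mem deg.summand_carrier[OF a] by blast

lemma ext_cong: "comp n a x = comp n a y \<Longrightarrow> ext n x = ext n y"
  by (simp add: extend_zero_def)

lemma ext_add:
  assumes "x \<in> carrier (chain_mod F n)" "y \<in> carrier (chain_mod F n)"
  shows "ext n (x \<oplus>\<^bsub>chain_mod F n\<^esub> y) = ext n x \<oplus>\<^bsub>chain_mod F (n + 1)\<^esub> ext n y"
proof (rule ext_eqI)
  show "ext n x \<oplus>\<^bsub>chain_mod F (n + 1)\<^esub> ext n y \<in> S (n + 1) a"
    using assms by (simp add: deg.summand_add ext_mem a)
  show "proj a (n + 1) (ext n x \<oplus>\<^bsub>chain_mod F (n + 1)\<^esub> ext n y) =
      W n (proj a n (comp n a (x \<oplus>\<^bsub>chain_mod F n\<^esub> y)))"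
    using assms module_hom_setD(2)[OF W_hom, OF proj_component_closed proj_component_closed]
    by (simp add: deg.component_add deg.component_carrier a ext_carrier
        flip: stratum_add proj_ext)
qed

lemma ext_smult:
  assumes "r \<in> carrier R" "x \<in> carrier (chain_mod F n)"
  shows "ext n (r \<odot>\<^bsub>chain_mod F n\<^esub> x) = r \<odot>\<^bsub>chain_mod F (n + 1)\<^esub> ext n x"
proof (rule ext_eqI)
  show "r \<odot>\<^bsub>chain_mod F (n + 1)\<^esub> ext n x \<in> S (n + 1) a"
    using assms by (simp add: deg.summand_smult ext_mem a)
  show "proj a (n + 1) (r \<odot>\<^bsub>chain_mod F (n + 1)\<^esub> ext n x) =
      W n (proj a n (comp n a (r \<odot>\<^bsub>chain_mod F n\<^esub> x)))"
    using assms module_hom_setD(3)[OF W_hom, OF _ proj_component_closed]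
    by (simp add: deg.component_smult deg.component_carrier a ext_carrier
        flip: stratum_smult proj_ext)
qed

lemma ext_zero: "ext n \<zero>\<^bsub>chain_mod F n\<^esub> = \<zero>\<^bsub>chain_mod F (n + 1)\<^esub>"
  \<comment> \<open>Additivity at 0 + 0 = 0 makes the value at zero idempotent, so it cancels to
    zero.\<close>
  using ext_add[of "\<zero>\<^bsub>chain_mod F n\<^esub>" n "\<zero>\<^bsub>chain_mod F n\<^esub>"] ext_carrier[of "\<zero>\<^bsub>chain_mod F n\<^esub>" n]
  by simp

lemma ext_other: "comp n a x = \<zero>\<^bsub>chain_mod F n\<^esub> \<Longrightarrow> ext n x = \<zero>\<^bsub>chain_mod F (n + 1)\<^esub>"
  using ext_cong[of n x "\<zero>\<^bsub>chain_mod F n\<^esub>"] by (simp add: ext_zero deg.component_zero a)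

text \<open>Since \<open>ext n x\<close> lies in the summand at \<open>a\<close>, it is its own
  component there and projects to a value of \<open>W n\<close>. The second application therefore
  meets the square of \<open>W\<close>.\<close>

lemma ext_ext:
  assumes x: "x \<in> carrier (chain_mod F n)"
  shows "ext (n + 1) (ext n x) = \<zero>\<^bsub>chain_mod F (n + 1 + 1)\<^esub>"
proof (rule ext_eqI)
  have "W (n + 1) (W n (proj a n (comp n a x))) = \<zero>\<^bsub>str a (n + 1 + 1)\<^esub>"
    using W proj_component_closed[OF x] by (simp add: vector_field_def)
  then show "proj a (n + 1 + 1) \<zero>\<^bsub>chain_mod F (n + 1 + 1)\<^esub> =
      W (n + 1) (proj a (n + 1) (comp (n + 1) a (ext n x)))"
    using x by (simp add: deg.component_same ext_mem proj_ext a stratum_zero)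
qed (rule deg.summand_zero[OF a])

lemma vector_field_ext: "vector_field R F ext"
  by (auto simp: vector_field_def chain_homotopy_def ext_carrier ext_add ext_smult ext_ext
      intro!: module_hom_setI)

end

section \<open>The sum of the extended fields over all strata\<close>

locale strata_fields = stratified_complex R P F S
  for R :: "('r, 'x) ring_scheme" and P :: "('p, 'y) gorder_scheme"
    and F :: "('r, 'm) chain_cpx" and S :: "int \<Rightarrow> 'p \<Rightarrow> 'm set" +
  fixes W :: "'p \<Rightarrow> int \<Rightarrow> 'm set \<Rightarrow> 'm set"
  assumes W: "\<And>a. a \<in> carrier P \<Longrightarrow> vector_field R (stratum P F S a) (W a)"
begin

abbreviation total :: "int \<Rightarrow> 'm \<Rightarrow> 'm" where
  "total \<equiv> sum_field P F S W"

lemma stratum_field: "a \<in> carrier P \<Longrightarrow> stratum_field R P F S a (W a)"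
  by (simp add: stratum_field_def stratum_field_axioms_def stratified_complex_axioms W)

lemmas ext_mem = stratum_field.ext_mem[OF stratum_field]
  and ext_cong = stratum_field.ext_cong[OF stratum_field]
  and ext_add = stratum_field.ext_add[OF stratum_field]
  and ext_smult = stratum_field.ext_smult[OF stratum_field]
  and ext_ext = stratum_field.ext_ext[OF stratum_field]
  and ext_other = stratum_field.ext_other[OF stratum_field]
  and proj_ext = stratum_field.proj_ext[OF stratum_field]

text \<open>The extension of \<open>W a\<close> kills \<open>x\<close> unless \<open>x\<close> has a
  nonzero component at \<open>a\<close>, which happens for finitely many indices only. So the sum
  defining \<open>total\<close> makes sense even for infinite \<open>P\<close>.\<close>

lemma finite_ext:
  assumes x: "x \<in> carrier (chain_mod F n)"
  shows "finite {a \<in> carrier P. extend_zero P F S a (W a) n x \<noteq> \<zero>\<^bsub>chain_mod F (n + 1)\<^esub>}"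
  by (rule finite_subset[OF _ deg.finite_support[OF x]]) (auto simp: ext_other)

text \<open>Each extension takes values in its own summand, so the terms of the sum are already its
  components.\<close>

lemma
  assumes x: "x \<in> carrier (chain_mod F n)"
  shows total_carrier: "total n x \<in> carrier (chain_mod F (n + 1))"
    and component_total:
      "a \<in> carrier P \<Longrightarrow> comp (n + 1) a (total n x) = extend_zero P F S a (W a) n x"
  unfolding sum_field_def
  using deg.component_finsupp_sum[OF ext_mem[OF _ x] finite_ext[OF x]] by auto

lemma vector_field_total: "vector_field R F total"
  unfolding vector_field_def chain_homotopy_def
proof (intro conjI allI ballI module_hom_setI)
  fix n x assume x: "x \<in> carrier (chain_mod F n)"
  show "total n x \<in> carrier (chain_mod F (n + 1))"
    using x by (rule total_carrier)
  show "total (n + 1) (total n x) = \<zero>\<^bsub>chain_mod F (n + 1 + 1)\<^esub>"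
  proof (rule deg.component_eqI)
    fix a assume a: "a \<in> carrier P"
    \<comment> \<open>At the index \<open>a\<close>, the elements \<open>total n x\<close> and the
      extension of \<open>W a\<close> at \<open>x\<close> have the same component. The second
      application at \<open>a\<close> sees nothing else, so it gives the square of one extension,
      which is zero.\<close>
    have "comp (n + 1) a (total n x) = comp (n + 1) a (extend_zero P F S a (W a) n x)"
      using x a by (simp add: component_total deg.component_same ext_mem)
    then have "extend_zero P F S a (W a) (n + 1) (total n x) = \<zero>\<^bsub>chain_mod F (n + 1 + 1)\<^esub>"
      using ext_cong[OF a] ext_ext[OF a x] by metis
    then show "comp (n + 1 + 1) a (total (n + 1) (total n x)) =
        comp (n + 1 + 1) a \<zero>\<^bsub>chain_mod F (n + 1 + 1)\<^esub>"
      unfolding component_total[OF total_carrier[OF x] a] deg.component_zero[OF a] .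
  qed (rule total_carrier[OF total_carrier[OF x]], rule deg.M.zero_closed)
  show "total n (r \<odot>\<^bsub>chain_mod F n\<^esub> x) = r \<odot>\<^bsub>chain_mod F (n + 1)\<^esub> total n x"
    if "r \<in> carrier R" for r
    by (rule deg.component_eqI[of _ "n + 1"])
      (simp_all add: x that total_carrier component_total deg.component_smult ext_smult)
  show "total n (x \<oplus>\<^bsub>chain_mod F n\<^esub> y) = total n x \<oplus>\<^bsub>chain_mod F (n + 1)\<^esub> total n y"
    if "y \<in> carrier (chain_mod F n)" for y
    by (rule deg.component_eqI[of _ "n + 1"])
      (simp_all add: x that total_carrier component_total deg.component_add ext_add)
qed

text \<open>An element of the summand at \<open>a\<close> has zero components elsewhere, so all the
  other extensions vanish on it.\<close>

lemma compatible_total: "compatible P S total"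
  unfolding compatible_def
proof (intro ballI allI image_subsetI)
  fix a n x assume a: "a \<in> carrier P" and x: "x \<in> S n a"
  then have carr: "x \<in> carrier (chain_mod F n)"
    by (rule deg.summand_carrier)
  show "total n x \<in> S (n + 1) a"
    using a x carr
    by (intro deg.mem_summandI) (auto simp: total_carrier component_total ext_other deg.component_other)
qed

lemma induced_total:
  assumes a: "a \<in> carrier P" and X: "X \<in> carrier (str a n)"
  shows "induced P F S a total n X = W a n X"
proof -
  obtain x where x: "x \<in> filt P F S a n" "X = proj a n x"
    using X by (auto simp: stratum_carrier)
  have carr: "x \<in> carrier (chain_mod F n)"
    using x(1) by (rule filt_carrier)
  have "induced P F S a total n X = proj a (n + 1) (total n x)"
    using induced_proj[OF vector_field_total compatible_total a x(1)] x(2) by simp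
  \<comment> \<open>The projection sees only the component at \<open>a\<close>, and for
    \<open>total n x\<close> this is the extension of \<open>W a\<close> alone.\<close>
  also have "\<dots> = proj a (n + 1) (comp (n + 1) a (total n x))"
    using compatible_filt[OF vector_field_total compatible_total x(1)] a
    by (simp add: proj_component)
  also have "\<dots> = W a n (proj a n (comp n a x))"
    using a carr by (simp add: component_total proj_ext)
  also have "\<dots> = W a n X"
    using a x by (simp add: proj_component)
  finally show ?thesis .
qed

end

section \<open>Induced fields, extended fields and their sum on a stratified complex\<close>

theorem proposition1p11:
  fixes R :: "('r, 'x) ring_scheme"
    and P :: "('p, 'y) gorder_scheme"
    and F :: "('r, 'm) chain_cpx"
    and S :: "int \<Rightarrow> 'p \<Rightarrow> 'm set"
  assumes "ring R"
    and "partial_order P"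
    and "chain_complex R F"
    and "stratification R P F S"
  shows
    "(\<forall>V. vector_field R F V \<and> compatible P S V \<longrightarrow>
        (\<forall>a\<in>carrier P.
           vector_field R (stratum P F S a) (induced P F S a V) \<and>
           (\<forall>n. \<forall>x\<in>filt P F S a n.
              V n x \<in> filt P F S a (n + 1) \<and>
              induced P F S a V n (stratum_proj P F S a n x)
                = stratum_proj P F S a (n + 1) (V n x)))) \<and>
     (\<forall>W. (\<forall>a\<in>carrier P. vector_field R (stratum P F S a) (W a)) \<longrightarrow>
        (\<forall>a\<in>carrier P.
           vector_field R F (extend_zero P F S a (W a)) \<and>
           (\<forall>n. \<forall>x\<in>S n a.
              extend_zero P F S a (W a) n x \<in> S (n + 1) a \<and>
              stratum_proj P F S a (n + 1) (extend_zero P F S a (W a) n x)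
                = W a n (stratum_proj P F S a n x)) \<and>
           (\<forall>b\<in>carrier P. b \<noteq> a \<longrightarrow>
              (\<forall>n. \<forall>x\<in>S n b. extend_zero P F S a (W a) n x = \<zero>\<^bsub>chain_mod F (n + 1)\<^esub>)))) \<and>
     (\<forall>W. (\<forall>a\<in>carrier P. vector_field R (stratum P F S a) (W a)) \<longrightarrow>
        (\<forall>n. \<forall>x\<in>carrier (chain_mod F n).
           finite {a \<in> carrier P. extend_zero P F S a (W a) n x \<noteq> \<zero>\<^bsub>chain_mod F (n + 1)\<^esub>}) \<and>
        vector_field R F (sum_field P F S W) \<and>
        compatible P S (sum_field P F S W) \<and>
        (\<forall>a\<in>carrier P. \<forall>n. \<forall>X\<in>carrier (chain_mod (stratum P F S a) n).
           induced P F S a (sum_field P F S W) n X = W a n X))"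
proof -
  interpret stratified_complex R P F S
    using assms by (simp add: stratified_complex_def stratified_complex_axioms_def)
  have fields: "strata_fields R P F S W"
    if "\<forall>a\<in>carrier P. vector_field R (stratum P F S a) (W a)" for W
    using that by (simp add: strata_fields_def strata_fields_axioms_def stratified_complex_axioms)
  \<comment> \<open>Cases 1 to 3 concern induced fields, 4 to 7 the extension of a single
    \<open>W a\<close>, and 8 to 11 the sum, starting with its pointwise finiteness.\<close>
  show ?thesis
  proof (intro conjI allI impI ballI, goal_cases)
    case (1 V a)
    then show ?case
      by (simp add: vector_field_induced)
  next
    case (2 V a n x)
    then show ?case
      by (simp add: compatible_filt)
  next
    case (3 V a n x)
    then show ?case
      by (simp add: induced_proj)
  next
    case (4 W a)
    then interpret stratum_field R P F S a "W a"
      using strata_fields.stratum_field[OF fields] by blast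
    show ?case
      by (rule vector_field_ext)
  next
    case (5 W a n x)
    then interpret stratum_field R P F S a "W a"
      using strata_fields.stratum_field[OF fields] by blast
    show ?case
      using 5 by (intro ext_mem deg.summand_carrier)
  next
    case (6 W a n x)
    then interpret stratum_field R P F S a "W a"
      using strata_fields.stratum_field[OF fields] by blast
    \<comment> \<open>As \<open>x\<close> lies in the summand at \<open>a\<close>, it equals its
      component there, so \<open>proj_ext\<close> speaks of \<open>x\<close> itself.\<close>
    show ?case
      using 6 proj_ext[of x n] deg.summand_carrier[of a x n] deg.component_same[of a x n] by simp
  next
    case (7 W a b n x)
    then interpret stratum_field R P F S a "W a"
      using strata_fields.stratum_field[OF fields] by blast
    show ?case
      using 7 by (intro ext_other deg.component_other[of a b]) auto
  next
    case (8 W n x)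
    then show ?case
      using strata_fields.finite_ext[OF fields] by blast
  next
    case (9 W)
    then show ?case
      using strata_fields.vector_field_total[OF fields] by blast
  next
    case (10 W)
    then show ?case
      using strata_fields.compatible_total[OF fields] by blast
  next
    case (11 W a n X)
    then show ?case
      using strata_fields.induced_total[OF fields] by blast
  qed
qed

end
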